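(* Let $n\geq2$ and let $\preceq$ be a nice $n$-ordering system on $(\omega_n,<)$ whose order type is bounded by $(\omega_n,\ldots,\omega_1)$. Let $\mathcal{Q}$ be the forcing notion defined below, $G\subseteq\mathcal{Q}$ a generic filter over $V$, and $\preceq^G$ the $(n+1)$-ordering system defined below. Then in $V[G]$, $\preceq^G$ has finite closures: every finite subset of $\omega_n$ is contained in a finite $\preceq^G$-closed set.
   Context: For $0<m<\omega$, an $m$-ordering system on a set $X$ assigns to each $s\in[X]^{<m}$ a relation $\preceq_s\subseteq X^2$, defined recursively: a $1$-ordering system is one with $\preceq_\emptyset$ a non-strict well-order of $X$; for $m>1$, $\preceq$ is an $m$-ordering system if $\preceq_\emptyset$ is a non-strict well-order of $X$ and for every $x_0\in X$ the function $\preceq^{x_0}$ on $[X_{\prec_\emptyset x_0}]^{<m-1}$ given by $\preceq^{x_0}_t=\preceq_{t\cup\{x_0\}}$ is an $(m-1)$-ordering system on $X_{\prec_\emptyset x_0}=\{x:x\prec_\emptyset x_0\}$. Here $\prec_s$ is $\preceq_s$ minus the diagonal and $\mathrm{dom}(\preceq_s)=\{x:(x,x)\in\preceq_s\}$. A set $S\subseteq X$ is closed for an $m$-ordering system if for every $s\subseteq S$ with $|s|=m-1$ and $a,b\in\mathrm{dom}(\preceq_s)$, $b\in S$ and $a\prec_s b$ imply $a\in S$. For $s\in[X]^k$, $0<k\leq m$, $\mathrm{Min}_\preceq s$ is the unique $y\in s$ with $y\in\mathrm{dom}(\preceq_{s\setminus\{y\}})$, and $\mathrm{predom}(\preceq_s)=\{x\in\mathrm{dom}(\preceq_{s'}):x\prec_{s'}y\}$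 where $y=\mathrm{Min}_\preceq s$, $s'=s\setminus\{y\}$. For $\alpha\leq\omega$ and a well-order $<$, $\alpha^<$ is the set of its first $\alpha$ elements. An $m$-ordering system on $(X,<^X)$ is nice if $\prec_\emptyset=<^X$ and for every $s\in[X]^{<m}$, with $\alpha=\min\{|\mathrm{dom}(\preceq_s)|,\omega\}$, the first $\alpha$ elements of $\prec_s$ form $\alpha^{<^X}$ and $\prec_s$ agrees with $<^X$ there. The bound means $\mathrm{otp}(\preceq_s)\leq\omega_{n-|s|}$ for $s\in[\omega_n]^{<n}$. Let $\mathrm{Inf}=\{s\in[\omega_n]^n:\mathrm{predom}(\preceq_s)\text{ is infinite}\}$ (equivalently $s\cap\omega=\emptyset$). $\mathcal{Q}$ is the set of finite partial functions $p$ from $\bigcup_{s\in\mathrm{Inf}}\mathrm{predom}(\preceq_s)\times\{s\}$ to $\omega$ such that for each $s\in\mathrm{Inf}$ the map $p_s(x)=p(x,s)$ is injective, ordered by inclusion (larger = stronger). For generic $G$, $g=\bigcup G$ is a function with domain $\bigcup_{s\in\mathrm{Inf}}\mathrm{predom}(\preceq_s)\times\{s\}$, injective on each fiber. $\preceq^G$ is the $(n+1)$-ordering system on $\omega_n$ agreeing with $\preceq$ on $[\omega_n]^{<n}$ and, for $s\in[\omega_n]^n$, with $\preceq^G_s$ the (non-strict) well-order on $\mathrm{predom}(\preceq_s)$ given by: the ordinal order if $s\notin\mathrm{Inf}$; and $x\prec^G_s y$ iff $g(x,s)<g(y,s)$ if $s\in\mathrm{Inf}$. *)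

theory Defs
  imports "HOL-Library.Ramsey" "HOL-Library.Extended_Nat"
begin

unbundle cardinal_syntax

section \<open>The ordinals \<open>\<omega>\<^sub>k\<close>\<close>

text \<open>
  \<open>omega_order k r\<close>: the well-order \<open>r\<close> has order type \<open>\<omega>\<^sub>k\<close>. The ordinal \<open>\<omega>\<^sub>n\<close> itself is
  represented by an arbitrary well-ordered set \<open>(Field r, r)\<close> of that order type. As \<open>cardSuc\<close>
  changes the underlying type, \<open>\<omega>\<^sub>k\<^sub>+\<^sub>1\<close> is described as the type of the cardinal successor of
  some order of type \<open>\<omega>\<^sub>k\<close> on the same type; such an order exists there, namely a proper initial
  segment of \<open>r\<close>.
\<close>

fun omega_order :: "nat \<Rightarrow> 'a rel \<Rightarrow> bool" where
  "omega_order 0 r \<longleftrightarrow> r =o natLeq"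
| "omega_order (Suc k) r \<longleftrightarrow> (\<exists>r' :: 'a rel. omega_order k r' \<and> r =o cardSuc r')"

definition otp_le_omega :: "'a rel \<Rightarrow> nat \<Rightarrow> bool" where
  "otp_le_omega R k \<longleftrightarrow> (\<exists>r' :: 'a rel. omega_order k r' \<and> R \<le>o r')"


section \<open>Ordering systems\<close>

text \<open>\<open>[X]\<^bsup>k\<^esup>\<close> is \<open>nsets X k\<close>; the following is \<open>[X]\<^bsup><m\<^esup>\<close>.\<close>

definition nsets_less :: "'a set \<Rightarrow> nat \<Rightarrow> 'a set set" where
  "nsets_less X m = {s. s \<subseteq> X \<and> finite s \<and> card s < m}"

definition strict :: "'a rel \<Rightarrow> 'a rel" where
  "strict R = R - Id"

definition dom_of :: "'a rel \<Rightarrow> 'a set" where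
  "dom_of R = {x. (x, x) \<in> R}"

text \<open>
  An assignment \<open>s \<mapsto> \<preceq>\<^sub>s\<close> is a function on all sets; its values outside \<open>[X]\<^bsup><m\<^esup>\<close> are junk and
  never matter. Ordering systems are only defined for \<open>m > 0\<close>.
\<close>

fun ordering_system :: "nat \<Rightarrow> 'a set \<Rightarrow> ('a set \<Rightarrow> 'a rel) \<Rightarrow> bool" where
  "ordering_system 0 X L \<longleftrightarrow> False"
| "ordering_system (Suc 0) X L \<longleftrightarrow> well_order_on X (L {})"
| "ordering_system (Suc (Suc m)) X L \<longleftrightarrow> well_order_on X (L {}) \<and>
     (\<forall>x0\<in>X. ordering_system (Suc m) {x \<in> X. (x, x0) \<in> strict (L {})} (\<lambda>t. L (t \<union> {x0})))"

definition Min_sys :: "('a set \<Rightarrow> 'a rel) \<Rightarrow> 'a set \<Rightarrow> 'a" where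
  "Min_sys L s = (THE y. y \<in> s \<and> y \<in> dom_of (L (s - {y})))"

definition predom :: "('a set \<Rightarrow> 'a rel) \<Rightarrow> 'a set \<Rightarrow> 'a set" where
  "predom L s = (let y = Min_sys L s; s' = s - {y}
     in {x \<in> dom_of (L s'). (x, y) \<in> strict (L s')})"

definition first_elems :: "enat \<Rightarrow> 'a rel \<Rightarrow> 'a set" where
  "first_elems \<alpha> R = {x \<in> Field R. finite (underS R x) \<and> enat (card (underS R x)) < \<alpha>}"

definition size_upto_omega :: "'a set \<Rightarrow> enat" where
  "size_upto_omega A = (if finite A then enat (card A) else \<infinity>)"

definition nice_ordering_system :: "nat \<Rightarrow> 'a rel \<Rightarrow> ('a set \<Rightarrow> 'a rel) \<Rightarrow> bool" where
  "nice_ordering_system m r L \<longleftrightarrow>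
     ordering_system m (Field r) L \<and>
     strict (L {}) = strict r \<and>
     (\<forall>s \<in> nsets_less (Field r) m.
        let \<alpha> = size_upto_omega (dom_of (L s)) in
          first_elems \<alpha> (L s) = first_elems \<alpha> r \<and>
          (\<forall>x \<in> first_elems \<alpha> r. \<forall>y \<in> first_elems \<alpha> r.
             (x, y) \<in> strict (L s) \<longleftrightarrow> (x, y) \<in> strict r))"

text \<open>Order type bounded by \<open>(\<omega>\<^sub>n, \<dots>, \<omega>\<^sub>1)\<close>, for an \<open>n\<close>-ordering system on \<open>X\<close>.\<close>

definition order_type_bounded :: "nat \<Rightarrow> 'a set \<Rightarrow> ('a set \<Rightarrow> 'a rel) \<Rightarrow> bool" where
  "order_type_bounded n X L \<longleftrightarrow> (\<forall>s \<in> nsets_less X n. otp_le_omega (L s) (n - card s))"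


section \<open>Truth in generic extensions\<close>

text \<open>
  The ground model \<open>V\<close> is the ambient universe, so that \<open>V\<close>-generic filters are not available as
  objects; as usual, ``\<open>\<phi>\<close> holds in \<open>V[G]\<close> for every \<open>V\<close>-generic filter \<open>G\<close>'' means that every
  condition forces \<open>\<phi>\<close>. A formula of the forcing language is represented by the predicate
  \<open>\<lambda>p. p \<tturnstile> \<phi>\<close>, and the connectives are given by the usual recursion for the forcing relation,
  with \<open>\<and>\<close>, \<open>\<not>\<close>, \<open>\<forall>\<close> as primitives. Here \<open>le q p\<close> means that \<open>q\<close> is stronger than \<open>p\<close>.

  Subsets in \<open>V[G]\<close> of a ground model set \<open>X\<close> are denoted by names \<open>\<tau> \<subseteq> X \<times> P\<close> (elements \<open>x\<close> of
  \<open>X\<close> stand for their check names): \<open>\<tau>\<^sup>G = {x. \<exists>p \<in> G. (x, p) \<in> \<tau>}\<close>, and every subset of \<open>X\<close>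
  in \<open>V[G]\<close> is of this form. Quantification over elements of a ground model set is a conjunction
  over its elements.
\<close>

type_synonym 'p fm = "'p \<Rightarrow> bool"

locale forcing =
  fixes P :: "'p set" and le :: "'p \<Rightarrow> 'p \<Rightarrow> bool"
begin

definition forced :: "'p fm \<Rightarrow> bool" where
  "forced \<phi> \<longleftrightarrow> (\<forall>p\<in>P. \<phi> p)"

definition names :: "'x set \<Rightarrow> ('x \<times> 'p) set set" where
  "names X = Pow (X \<times> P)"

text \<open>The canonical name of the generic filter.\<close>

definition gen :: "('p \<times> 'p) set" where
  "gen = {(p, p) | p. p \<in> P}"

text \<open>A statement about ground model objects that is evaluated in \<open>V\<close>; only used for
  absolute facts.\<close>

definition fground :: "bool \<Rightarrow> 'p fm" where
  "fground b p \<longleftrightarrow> b"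

text \<open>\<open>x \<in> \<tau>\<^sup>G\<close>: the conditions below some \<open>r\<close> with \<open>(x, r) \<in> \<tau>\<close> are dense below \<open>p\<close>.\<close>

definition fmem :: "'x \<Rightarrow> ('x \<times> 'p) set \<Rightarrow> 'p fm" (infix "\<^bold>\<in>" 50) where
  "(x \<^bold>\<in> \<tau>) p \<longleftrightarrow>
     (\<forall>q\<in>P. le q p \<longrightarrow> (\<exists>q'\<in>P. le q' q \<and> (\<exists>r\<in>P. (x, r) \<in> \<tau> \<and> le q' r)))"

definition fneg :: "'p fm \<Rightarrow> 'p fm" ("\<^bold>\<not> _" [40] 40) where
  "(\<^bold>\<not> \<phi>) p \<longleftrightarrow> (\<forall>q\<in>P. le q p \<longrightarrow> \<not> \<phi> q)"

definition fconj :: "'p fm \<Rightarrow> 'p fm \<Rightarrow> 'p fm" (infixr "\<^bold>\<and>" 35) where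
  "(\<phi> \<^bold>\<and> \<psi>) p \<longleftrightarrow> \<phi> p \<and> \<psi> p"

definition fall :: "'x set \<Rightarrow> ('x \<Rightarrow> 'p fm) \<Rightarrow> 'p fm" where
  "fall X \<phi> p \<longleftrightarrow> (\<forall>x\<in>X. \<phi> x p)"

definition fdisj :: "'p fm \<Rightarrow> 'p fm \<Rightarrow> 'p fm" (infixr "\<^bold>\<or>" 30) where
  "(\<phi> \<^bold>\<or> \<psi>) = (\<^bold>\<not> ((\<^bold>\<not> \<phi>) \<^bold>\<and> (\<^bold>\<not> \<psi>)))"

definition fimp :: "'p fm \<Rightarrow> 'p fm \<Rightarrow> 'p fm" (infixr "\<^bold>\<longrightarrow>" 25) where
  "(\<phi> \<^bold>\<longrightarrow> \<psi>) = (\<^bold>\<not> (\<phi> \<^bold>\<and> (\<^bold>\<not> \<psi>)))"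

definition fex :: "'x set \<Rightarrow> ('x \<Rightarrow> 'p fm) \<Rightarrow> 'p fm" where
  "fex X \<phi> = (\<^bold>\<not> fall X (\<lambda>x. \<^bold>\<not> \<phi> x))"

definition fsubset :: "'x set \<Rightarrow> ('x \<times> 'p) set \<Rightarrow> ('x \<times> 'p) set \<Rightarrow> 'p fm" where
  "fsubset X \<sigma> \<tau> = fall X (\<lambda>x. x \<^bold>\<in> \<sigma> \<^bold>\<longrightarrow> x \<^bold>\<in> \<tau>)"

text \<open>\<open>\<tau> \<subseteq> X\<close> is finite in \<open>V[G]\<close>: some \<open>f \<in> V[G]\<close> is a bijection from some \<open>k < \<omega>\<close> onto \<open>\<tau>\<close>.\<close>

definition fbij :: "'x set \<Rightarrow> nat \<Rightarrow> ((nat \<times> 'x) \<times> 'p) set \<Rightarrow> ('x \<times> 'p) set \<Rightarrow> 'p fm" where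
  "fbij X k f \<tau> =
     (fall {..<k} (\<lambda>i. fex X (\<lambda>x. (i, x) \<^bold>\<in> f)) \<^bold>\<and>
      fall {..<k} (\<lambda>i. fall X (\<lambda>x. fall X (\<lambda>y.
        (i, x) \<^bold>\<in> f \<^bold>\<and> (i, y) \<^bold>\<in> f \<^bold>\<longrightarrow> fground (x = y)))) \<^bold>\<and>
      fall {..<k} (\<lambda>i. fall {..<k} (\<lambda>j. fall X (\<lambda>x.
        (i, x) \<^bold>\<in> f \<^bold>\<and> (j, x) \<^bold>\<in> f \<^bold>\<longrightarrow> fground (i = j)))) \<^bold>\<and>
      fall {..<k} (\<lambda>i. fall X (\<lambda>x. (i, x) \<^bold>\<in> f \<^bold>\<longrightarrow> x \<^bold>\<in> \<tau>)) \<^bold>\<and>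
      fall X (\<lambda>x. x \<^bold>\<in> \<tau> \<^bold>\<longrightarrow> fex {..<k} (\<lambda>i. (i, x) \<^bold>\<in> f)))"

definition ffinite :: "'x set \<Rightarrow> ('x \<times> 'p) set \<Rightarrow> 'p fm" where
  "ffinite X \<tau> = fex UNIV (\<lambda>k. fex (names ({..<k} \<times> X)) (\<lambda>f. fbij X k f \<tau>))"

text \<open>
  An ordering system in \<open>V[G]\<close> on a ground model set is given by the formulas \<open>R s x y\<close>
  expressing \<open>x \<preceq>\<^sub>s y\<close>. Its indices \<open>s\<close> range over ground model sets, since \<open>V\<close> and \<open>V[G]\<close> have
  the same finite subsets of a ground model set.
\<close>

definition fstrict :: "('a set \<Rightarrow> 'a \<Rightarrow> 'a \<Rightarrow> 'p fm) \<Rightarrow> 'a set \<Rightarrow> 'a \<Rightarrow> 'a \<Rightarrow> 'p fm" where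
  "fstrict R s x y = (R s x y \<^bold>\<and> fground (x \<noteq> y))"

definition fdom :: "('a set \<Rightarrow> 'a \<Rightarrow> 'a \<Rightarrow> 'p fm) \<Rightarrow> 'a set \<Rightarrow> 'a \<Rightarrow> 'p fm" where
  "fdom R s x = R s x x"

definition fclosed ::
  "nat \<Rightarrow> 'a set \<Rightarrow> ('a set \<Rightarrow> 'a \<Rightarrow> 'a \<Rightarrow> 'p fm) \<Rightarrow> ('a \<times> 'p) set \<Rightarrow> 'p fm" where
  "fclosed m X R S = fall (nsets X (m - 1)) (\<lambda>s.
     fall s (\<lambda>x. x \<^bold>\<in> S) \<^bold>\<longrightarrow>
     fall X (\<lambda>a. fall X (\<lambda>b.
       fdom R s a \<^bold>\<and> fdom R s b \<^bold>\<and> b \<^bold>\<in> S \<^bold>\<and> fstrict R s a b \<^bold>\<longrightarrow> a \<^bold>\<in> S)))"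

definition fhas_finite_closures ::
  "nat \<Rightarrow> 'a set \<Rightarrow> ('a set \<Rightarrow> 'a \<Rightarrow> 'a \<Rightarrow> 'p fm) \<Rightarrow> 'p fm" where
  "fhas_finite_closures m X R = fall (names X) (\<lambda>A.
     ffinite X A \<^bold>\<longrightarrow>
     fex (names X) (\<lambda>S. fsubset X A S \<^bold>\<and> ffinite X S \<^bold>\<and> fclosed m X R S))"

end


section \<open>The forcing notion and the generic ordering system\<close>

text \<open>Throughout, \<open>(Field r, r)\<close> plays the role of \<open>(\<omega>\<^sub>n, \<le>)\<close>, and \<open>L\<close> that of \<open>\<preceq>\<close>.\<close>

definition Inf_sets :: "nat \<Rightarrow> 'a rel \<Rightarrow> ('a set \<Rightarrow> 'a rel) \<Rightarrow> 'a set set" where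
  "Inf_sets n r L = {s \<in> nsets (Field r) n. infinite (predom L s)}"

definition Q_dom :: "nat \<Rightarrow> 'a rel \<Rightarrow> ('a set \<Rightarrow> 'a rel) \<Rightarrow> ('a \<times> 'a set) set" where
  "Q_dom n r L = (\<Union>s \<in> Inf_sets n r L. predom L s \<times> {s})"

definition Q_conds :: "nat \<Rightarrow> 'a rel \<Rightarrow> ('a set \<Rightarrow> 'a rel) \<Rightarrow> ('a \<times> 'a set \<rightharpoonup> nat) set" where
  "Q_conds n r L = {p. finite (dom p) \<and> dom p \<subseteq> Q_dom n r L \<and>
     (\<forall>s \<in> Inf_sets n r L. inj_on (\<lambda>x. p (x, s)) {x. (x, s) \<in> dom p})}"

definition Q_le :: "('a \<times> 'a set \<rightharpoonup> nat) \<Rightarrow> ('a \<times> 'a set \<rightharpoonup> nat) \<Rightarrow> bool" where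
  "Q_le q p \<longleftrightarrow> p \<subseteq>\<^sub>m q"

context
  fixes n :: nat and r :: "'a rel" and L :: "'a set \<Rightarrow> 'a rel"
begin

interpretation forcing "Q_conds n r L" Q_le .

text \<open>\<open>g(x, s) = k\<close>, where \<open>g = \<Union>G\<close>.\<close>

definition g_eq :: "'a \<Rightarrow> 'a set \<Rightarrow> nat \<Rightarrow> ('a \<times> 'a set \<rightharpoonup> nat) fm" where
  "g_eq x s k = fex (Q_conds n r L) (\<lambda>p. fconj (fmem p gen) (fground (p (x, s) = Some k)))"

definition g_less :: "'a set \<Rightarrow> 'a \<Rightarrow> 'a \<Rightarrow> ('a \<times> 'a set \<rightharpoonup> nat) fm" where
  "g_less s x y = fex UNIV (\<lambda>k. fex UNIV (\<lambda>l.
     fconj (g_eq x s k) (fconj (g_eq y s l) (fground (k < l)))))"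

text \<open>The formula \<open>x \<preceq>\<^sup>G\<^sub>s y\<close>, for \<open>s \<in> [\<omega>\<^sub>n]\<^bsup><n+1\<^esup>\<close>. The case distinctions concern ground model
  objects only.\<close>

definition generic_system :: "'a set \<Rightarrow> 'a \<Rightarrow> 'a \<Rightarrow> ('a \<times> 'a set \<rightharpoonup> nat) fm" where
  "generic_system s x y =
     (if s \<in> nsets_less (Field r) n then fground ((x, y) \<in> L s)
      else if s \<notin> Inf_sets n r L then
        fground (x \<in> predom L s \<and> y \<in> predom L s \<and> (x, y) \<in> r)
      else
        fconj (fground (x \<in> predom L s \<and> y \<in> predom L s)) (fdisj (fground (x = y)) (g_less s x y)))"

end

end

theory Submission
  imports Defs
begin

text \<open>
  Call the first \<open>\<omega>\<close> elements of \<open>r\<close> natural numbers. By niceness, \<open>predom L s\<close> contains all of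
  them if \<open>s\<close> is in \<open>Inf_sets n r L\<close>, and otherwise \<open>predom L s\<close> lies below \<open>Min_sys L s\<close>, which is
  then itself a natural number. Given a condition \<open>p\<close> and a finite set \<open>A\<close>, add to \<open>A\<close> the points
  mentioned by \<open>p\<close> and then a long initial segment of the natural numbers, to get a finite set \<open>S\<close>.
  Then \<open>S\<close> contains \<open>predom L s\<close> whenever \<open>s \<subseteq> S\<close> is not in \<open>Inf_sets n r L\<close>. For the other
  \<open>s \<subseteq> S\<close>, the set \<open>S \<inter> predom L s\<close> is larger than all values of \<open>p\<close>, hence \<open>p\<close> extends
  to a condition enumerating \<open>S \<inter> predom L s\<close> by an initial segment of \<open>\<omega>\<close>. As generic
  enumerations are injective, this condition forces \<open>S\<close> to be closed.
\<close>

section \<open>Forcing over a preorder\<close>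

locale preorder_forcing = forcing P le for P :: "'p set" and le :: "'p \<Rightarrow> 'p \<Rightarrow> bool" +
  assumes le_refl: "p \<in> P \<Longrightarrow> le p p"
    and le_trans: "le p q \<Longrightarrow> le q s \<Longrightarrow> le p s"
begin

text \<open>As \<open>fex\<close> is a negated universal negation, witnesses need only appear
  densely below \<open>p\<close>, and different extensions may pick different ones.\<close>

lemma fex_iff:
  "fex X \<phi> p \<longleftrightarrow> (\<forall>q\<in>P. le q p \<longrightarrow> (\<exists>x\<in>X. \<exists>q'\<in>P. le q' q \<and> \<phi> x q'))"
  unfolding fex_def fneg_def fall_def by blast

lemma fexI:
  assumes "x \<in> X" "\<And>q. q \<in> P \<Longrightarrow> le q p \<Longrightarrow> \<phi> x q"
  shows "fex X \<phi> p"
  unfolding fex_iff using assms le_refl by blast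

lemma fexE:
  assumes "fex X \<phi> p" "p \<in> P"
  obtains x q where "x \<in> X" "q \<in> P" "le q p" "\<phi> x q"
  using assms le_refl unfolding fex_iff by blast

lemma fex_mono: "fex X \<phi> p \<Longrightarrow> le q p \<Longrightarrow> fex X \<phi> q"
  unfolding fex_iff using le_trans by blast

text \<open>Formulas are arbitrary predicates on conditions, so forcing the conclusion densely below
  \<open>q\<close> does not in general mean forcing it at \<open>q\<close>.\<close>

lemma fimp_iff:
  "(\<phi> \<^bold>\<longrightarrow> \<psi>) p \<longleftrightarrow> (\<forall>q\<in>P. le q p \<longrightarrow> \<phi> q \<longrightarrow> (\<exists>q'\<in>P. le q' q \<and> \<psi> q'))"
  unfolding fimp_def fneg_def fconj_def by blast

lemma fimpI:
  assumes "\<And>q. q \<in> P \<Longrightarrow> le q p \<Longrightarrow> \<phi> q \<Longrightarrow> \<psi> q"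
  shows "(\<phi> \<^bold>\<longrightarrow> \<psi>) p"
  unfolding fimp_iff using assms le_refl by blast

lemma fdisjE:
  assumes "(\<phi> \<^bold>\<or> \<psi>) p" "p \<in> P"
  obtains q where "q \<in> P" "le q p" "\<phi> q \<or> \<psi> q"
  using assms le_refl unfolding fdisj_def fneg_def fconj_def by blast

lemma fmem_mono: "(x \<^bold>\<in> \<tau>) p \<Longrightarrow> le q p \<Longrightarrow> (x \<^bold>\<in> \<tau>) q"
  unfolding fmem_def using le_trans by blast

text \<open>\<open>T \<times> P\<close> serves as the check name of \<open>T\<close>: all conditions
  decide membership in it alike.\<close>

lemma fmem_check: "p \<in> P \<Longrightarrow> (x \<^bold>\<in> T \<times> P) p \<longleftrightarrow> x \<in> T"
  unfolding fmem_def using le_refl by blast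

text \<open>That \<open>p\<close> forces \<open>a\<close> into the generic filter means that
  conditions below \<open>a\<close> are dense below \<open>p\<close>; it does not say that
  \<open>p\<close> itself lies below \<open>a\<close>.\<close>

lemma fmem_gen:
  assumes "(a \<^bold>\<in> gen) p" "p \<in> P"
  obtains q where "q \<in> P" "le q p" "le q a"
  using assms le_refl unfolding fmem_def gen_def by blast

text \<open>A ground model enumeration \<open>e\<close> of \<open>S\<close>, paired with all
  conditions, names the bijection that \<open>ffinite\<close> asks for.\<close>

lemma ffinite_check:
  assumes "finite S" "S \<subseteq> X"
  shows "ffinite X (S \<times> P) p"
proof -
  obtain e where e: "bij_betw e {..<card S} S"
    using ex_bij_betw_nat_finite[OF assms(1)] by (auto simp: lessThan_atLeast0)
  define f where "f = (\<lambda>i. (i, e i)) ` {..<card S} \<times> P"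
  have f: "((i, x) \<^bold>\<in> f) q \<longleftrightarrow> i < card S \<and> x = e i" if "q \<in> P" for i x q
    unfolding f_def fmem_check[OF that] by auto
  have eS: "e i \<in> S" if "i < card S" for i
    using e that by (auto simp: bij_betw_def)
  have inj: "i = j" if "i < card S" "j < card S" "e i = e j" for i j
    using e that by (auto simp: bij_betw_def inj_on_def)
  have surj: "\<exists>i<card S. x = e i" if "x \<in> S" for x
    using e that by (auto simp: bij_betw_def)
  have bij: "fbij X (card S) f (S \<times> P) q" if "q \<in> P" for q
  proof -
    have "fex X (\<lambda>x. (i, x) \<^bold>\<in> f) q" if "i < card S" for i
      using eS[OF that] assms(2) that f by (intro fexI[of "e i"]) auto
    \<comment> \<open>The conjunction is spelled out pointwise to match the goal after rewriting
      with \<open>fconj_def[abs_def]\<close>.\<close>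
    moreover have "((\<lambda>q. ((i, x) \<^bold>\<in> f) q \<and> ((i, y) \<^bold>\<in> f) q) \<^bold>\<longrightarrow> fground (x = y)) q" for i x y
      using f by (intro fimpI) (simp add: fground_def)
    moreover have "((\<lambda>q. ((i, x) \<^bold>\<in> f) q \<and> ((j, x) \<^bold>\<in> f) q) \<^bold>\<longrightarrow> fground (i = j)) q" for i j x
      using f inj[of i j] by (intro fimpI) (auto simp: fground_def)
    moreover have "((i, x) \<^bold>\<in> f \<^bold>\<longrightarrow> x \<^bold>\<in> S \<times> P) q" for i x
      using f eS by (intro fimpI) (simp add: fmem_check)
    moreover have "(x \<^bold>\<in> S \<times> P \<^bold>\<longrightarrow> fex {..<card S} (\<lambda>i. (i, x) \<^bold>\<in> f)) q" for x
    proof (rule fimpI)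
      fix q' assume q': "q' \<in> P" "(x \<^bold>\<in> S \<times> P) q'"
      then obtain i where "i < card S" "x = e i" using surj by (auto simp: fmem_check)
      then show "fex {..<card S} (\<lambda>i. (i, x) \<^bold>\<in> f) q'"
        using f by (intro fexI[of i]) auto
    qed
    ultimately show ?thesis
      unfolding fbij_def fall_def by (simp add: fconj_def[abs_def])
  qed
  have "f \<in> names ({..<card S} \<times> X)"
    unfolding names_def f_def using eS assms(2) by auto
  then show ?thesis
    unfolding ffinite_def by (intro fexI[of "card S"] fexI[of f] bij) auto
qed

text \<open>The condition \<open>p\<close> need not decide the set named by \<open>\<tau>\<close>,
  but some \<open>q\<close> below it decides the finitely many values of a named enumeration
  \<open>f\<close>. These values form \<open>A\<close>; below \<open>q\<close>, functionality and
  surjectivity of \<open>f\<close> leave no room for further elements.\<close>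

lemma ffinite_cover:
  assumes "ffinite X \<tau> p" "p \<in> P"
  obtains q A where "q \<in> P" "le q p" "A \<subseteq> X" "finite A"
    "\<And>q' x. q' \<in> P \<Longrightarrow> le q' q \<Longrightarrow> x \<in> X \<Longrightarrow> (x \<^bold>\<in> \<tau>) q' \<Longrightarrow> x \<in> A"
proof -
  obtain k p1 where p1: "p1 \<in> P" "le p1 p" "fex (names ({..<k} \<times> X)) (\<lambda>f. fbij X k f \<tau>) p1"
    using assms unfolding ffinite_def by (elim fexE[where p = p])
  obtain f p2 where p2: "p2 \<in> P" "le p2 p1" "fbij X k f \<tau> p2"
    using p1 by (elim fexE[where p = p1])
  have tot: "fex X (\<lambda>x. (i, x) \<^bold>\<in> f) p2" if "i < k" for i
    using p2(3) that unfolding fbij_def fconj_def fall_def by blast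
  have fn: "((\<lambda>p. ((i, x) \<^bold>\<in> f) p \<and> ((i, y) \<^bold>\<in> f) p) \<^bold>\<longrightarrow> fground (x = y)) p2"
    if "i < k" "x \<in> X" "y \<in> X" for i x y
    using p2(3) that unfolding fbij_def fall_def by (auto simp: fconj_def[abs_def])
  have sur: "(x \<^bold>\<in> \<tau> \<^bold>\<longrightarrow> fex {..<k} (\<lambda>i. (i, x) \<^bold>\<in> f)) p2" if "x \<in> X" for x
    using p2(3) that unfolding fbij_def fconj_def fall_def by blast
  \<comment> \<open>Values are decided one at a time, along a descending chain of
    conditions.\<close>
  have "\<exists>q\<in>P. le q p2 \<and> (\<exists>e. \<forall>i<j. e i \<in> X \<and> ((i, e i) \<^bold>\<in> f) q)" if "j \<le> k" for j
    using that
  proof (induction j)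
    case 0
    then show ?case using p2(1) le_refl by auto
  next
    case (Suc j)
    then obtain q e where q: "q \<in> P" "le q p2" "\<forall>i<j. e i \<in> X \<and> ((i, e i) \<^bold>\<in> f) q"
      by auto
    obtain x q' where q': "q' \<in> P" "le q' q" "x \<in> X" "((j, x) \<^bold>\<in> f) q'"
      using tot[of j] Suc.prems q(1,2) le_trans unfolding fex_iff by (meson Suc_le_lessD)
    have "\<forall>i<Suc j. (e(j := x)) i \<in> X \<and> ((i, (e(j := x)) i) \<^bold>\<in> f) q'"
      using q(3) q'(3,4) fmem_mono[OF _ q'(2)] unfolding less_Suc_eq by fastforce
    then show ?case
      using q' q(2) le_trans by blast
  qed
  from this[of k] obtain q e where q: "q \<in> P" "le q p2"
    and e: "\<And>i. i < k \<Longrightarrow> e i \<in> X" "\<And>i. i < k \<Longrightarrow> ((i, e i) \<^bold>\<in> f) q"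
    by auto
  have cover: "x \<in> e ` {..<k}" if q': "q' \<in> P" "le q' q" and x: "x \<in> X" "(x \<^bold>\<in> \<tau>) q'" for q' x
  proof -
    have "le q' p2"
      using q' q le_trans by blast
    then obtain q1 where q1: "q1 \<in> P" "le q1 q'" "fex {..<k} (\<lambda>i. (i, x) \<^bold>\<in> f) q1"
      using sur[OF x(1)] q' x(2) unfolding fimp_iff by blast
    then obtain i q2 where i: "i < k" "q2 \<in> P" "le q2 q1" "((i, x) \<^bold>\<in> f) q2"
      by (elim fexE) auto
    have "le q2 q" "le q2 p2"
      using i(3) q1(2) q'(2) \<open>le q' p2\<close> le_trans by blast+
    \<comment> \<open>Below \<open>q\<close> the value at \<open>i\<close> is already
      \<open>e i\<close>, so functionality, forced by \<open>p2\<close>, identifies \<open>x\<close>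
      with it.\<close>
    have "((i, x) \<^bold>\<in> f) q2 \<and> ((i, e i) \<^bold>\<in> f) q2"
      using i(4) fmem_mono[OF e(2)[OF i(1)] \<open>le q2 q\<close>] by simp
    then have "x = e i"
      using fn[OF i(1) x(1) e(1)[OF i(1)]] i(2) \<open>le q2 p2\<close> unfolding fimp_iff fground_def by blast
    then show ?thesis using i(1) by auto
  qed
  show thesis
  proof (rule that)
    show "q \<in> P" by fact
    show "le q p" using q(2) p2(2) p1(2) le_trans by blast
    show "e ` {..<k} \<subseteq> X" using e(1) by auto
    show "finite (e ` {..<k})" by simp
  qed (rule cover)
qed

end

lemma preorder_forcing_Q: "preorder_forcing Q Q_le"
  unfolding preorder_forcing_def Q_le_def by (auto intro: map_le_trans)


section \<open>Ordering systems\<close>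

lemma dom_of_Well_order: "Well_order R \<Longrightarrow> dom_of R = Field R"
  unfolding dom_of_def well_order_on_def linear_order_on_def partial_order_on_def
    preorder_on_def refl_on_def by (auto simp: Field_def)

text \<open>The maximum is the \<open>x0\<close> at which the recursion in
  \<open>ordering_system\<close> is entered, since all other points of the index set lie below
  it.\<close>

lemma well_order_on_finite_max:
  assumes "well_order_on X R" "finite s" "s \<noteq> {}" "s \<subseteq> X"
  obtains x where "x \<in> s" "\<And>z. z \<in> s \<Longrightarrow> (z, x) \<in> R"
proof -
  have tot: "total_on X R" and refl: "refl_on X R" and tr: "trans R"
    using assms(1)
    unfolding well_order_on_def linear_order_on_def partial_order_on_def preorder_on_def by auto
  have "\<exists>x\<in>s. \<forall>z\<in>s. (z, x) \<in> R"
    using assms(2-4)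
  proof (induction s rule: finite_ne_induct)
    case (singleton x)
    then show ?case using refl by (auto simp: refl_on_def)
  next
    case (insert a s)
    then obtain x where x: "x \<in> s" "\<forall>z\<in>s. (z, x) \<in> R" by auto
    have aa: "(a, a) \<in> R" using insert.prems refl by (auto simp: refl_on_def)
    have "(a, x) \<in> R \<or> (x, a) \<in> R"
      using tot insert.prems x(1) insert.hyps unfolding total_on_def by (metis insert_subset subsetD)
    then show ?case
    proof
      assume "(a, x) \<in> R"
      then show ?thesis using x by auto
    next
      assume "(x, a) \<in> R"
      then have "\<forall>z\<in>insert a s. (z, a) \<in> R" using x aa tr by (auto dest: transD)
      then show ?thesis by blast
    qed
  qed
  then show thesis using that by blast
qed

text \<open>Induction on \<open>m\<close>: with \<open>x0\<close> the largest element of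
  \<open>t\<close>, \<open>L t\<close> is the value at \<open>t - {x0}\<close> of the smaller system
  below \<open>x0\<close>. So \<open>x0\<close> bounds the field strictly; the clause recording such
  a bound serves the uniqueness of minima.\<close>

lemma ordering_system_Well_order:
  assumes "ordering_system m X L" "finite t" "t \<subseteq> X" "card t < m"
  shows "Well_order (L t) \<and> (t \<noteq> {} \<longrightarrow> (\<forall>x\<in>Field (L t). \<exists>z\<in>t. (x, z) \<in> strict (L {})))
    \<and> Field (L t) \<subseteq> X"
  using assms
proof (induction m X L arbitrary: t rule: ordering_system.induct)
  case (1 X L)
  then show ?case by simp
next
  case (2 X L)
  then show ?case using well_order_on_Well_order[of X "L {}"] by auto
next
  case (3 m X L)
  show ?case
  proof (cases "t = {}")
    case True
    then show ?thesis using "3.prems"(1) well_order_on_Well_order[of X "L {}"] by auto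
  next
    case False
    have wo: "well_order_on X (L {})" using "3.prems"(1) by simp
    obtain x0 where x0: "x0 \<in> t" "\<And>z. z \<in> t \<Longrightarrow> (z, x0) \<in> L {}"
      using well_order_on_finite_max[OF wo "3.prems"(2) False "3.prems"(3)] by blast
    define Y where "Y = {x \<in> X. (x, x0) \<in> strict (L {})}"
    have t: "t - {x0} \<union> {x0} = t" using x0(1) by auto
    have "ordering_system (Suc m) Y (\<lambda>t. L (t \<union> {x0}))"
      using "3.prems" x0(1) unfolding Y_def by auto
    moreover have "t - {x0} \<subseteq> Y"
      using "3.prems"(3) x0 unfolding Y_def strict_def by auto
    moreover have "card (t - {x0}) < Suc m"
      using "3.prems"(2,4) x0(1) by simp
    ultimately have "Well_order (L t)" "Field (L t) \<subseteq> Y"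
      using "3.IH"[of x0 "t - {x0}"] "3.prems"(2,3) x0(1) t unfolding Y_def by auto
    then show ?thesis
      using x0(1) unfolding Y_def by auto
  qed
qed

text \<open>Peel off the largest element \<open>x0\<close> of \<open>s\<close> and use induction
  below it. If \<open>s\<close> has other elements, \<open>x0\<close> is no candidate: each point in
  the field of \<open>L (s - {x0})\<close> is strictly below some point of \<open>s\<close>, which
  the maximum is not.\<close>

lemma ordering_system_Min_unique:
  assumes "ordering_system m X L" "finite s" "s \<subseteq> X" "s \<noteq> {}" "card s \<le> m"
  shows "\<exists>!y. y \<in> s \<and> y \<in> dom_of (L (s - {y}))"
  using assms
proof (induction m X L arbitrary: s rule: ordering_system.induct)
  case (1 X L)
  then show ?case by simp
next
  case (2 X L)
  then obtain y where "s = {y}"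
    by (metis One_nat_def card_1_singletonE card_gt_0_iff le_antisym Suc_leI)
  moreover have "Well_order (L {})" "Field (L {}) = X"
    using "2.prems"(1) well_order_on_Well_order[of X "L {}"] by auto
  ultimately show ?case
    using "2.prems"(3) by (auto simp: dom_of_Well_order)
next
  case (3 m X L)
  have wo: "well_order_on X (L {})" using "3.prems"(1) by simp
  obtain x0 where x0: "x0 \<in> s" "\<And>z. z \<in> s \<Longrightarrow> (z, x0) \<in> L {}"
    using well_order_on_finite_max[OF wo "3.prems"(2,4,3)] by blast
  show ?case
  proof (cases "s = {x0}")
    case True
    have "Well_order (L {})" "Field (L {}) = X"
      using wo well_order_on_Well_order[of X "L {}"] by auto
    then show ?thesis
      using True "3.prems"(3) by (auto simp: dom_of_Well_order)
  next
    case False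
    define Y where "Y = {x \<in> X. (x, x0) \<in> strict (L {})}"
    have "ordering_system (Suc m) Y (\<lambda>t. L (t \<union> {x0}))"
      using "3.prems" x0(1) unfolding Y_def by auto
    moreover have "s - {x0} \<subseteq> Y"
      using "3.prems"(3) x0 unfolding Y_def strict_def by auto
    moreover have "card (s - {x0}) \<le> Suc m"
      using "3.prems"(2,5) x0(1) by simp
    moreover have "s - {x0} \<noteq> {}"
      using False x0(1) by auto
    ultimately have ex1: "\<exists>!y. y \<in> s - {x0} \<and> y \<in> dom_of (L (s - {x0} - {y} \<union> {x0}))"
      using "3.IH"[of x0 "s - {x0}"] "3.prems"(2,3) x0(1) unfolding Y_def by blast
    have eq: "s - {x0} - {y} \<union> {x0} = s - {y}" if "y \<in> s - {x0}" for y
      using that x0(1) by auto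
    have "card (s - {x0}) < Suc (Suc m)"
      using "3.prems"(2,5) x0(1) by simp
    then have wo': "Well_order (L (s - {x0}))"
      "\<forall>x\<in>Field (L (s - {x0})). \<exists>z\<in>s - {x0}. (x, z) \<in> strict (L {})"
      using ordering_system_Well_order[OF "3.prems"(1), of "s - {x0}"] "3.prems"(2,3)
        \<open>s - {x0} \<noteq> {}\<close> by auto
    have "antisym (L {})"
      using wo unfolding well_order_on_def linear_order_on_def partial_order_on_def by simp
    then have "x0 \<notin> dom_of (L (s - {x0}))"
      using wo' x0 by (auto simp: dom_of_Well_order strict_def dest: antisymD)
    then show ?thesis
      using ex1 eq by (metis DiffD1 DiffI singletonD)
  qed
qed

lemma Min_sys:
  assumes "ordering_system m X L" "s \<in> nsets X m"
  shows "Min_sys L s \<in> s" "Min_sys L s \<in> dom_of (L (s - {Min_sys L s}))"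
proof -
  have s: "finite s" "s \<subseteq> X" "card s = m"
    using assms(2) by (auto simp: nsets_def)
  \<comment> \<open>\<open>ordering_system 0\<close> is false, so \<open>m > 0\<close> and
    \<open>s\<close> has an element.\<close>
  moreover have "s \<noteq> {}"
    using assms(1) s by (cases m) auto
  ultimately have "\<exists>!y. y \<in> s \<and> y \<in> dom_of (L (s - {y}))"
    using ordering_system_Min_unique[OF assms(1)] by simp
  from theI'[OF this]
  show "Min_sys L s \<in> s" "Min_sys L s \<in> dom_of (L (s - {Min_sys L s}))"
    unfolding Min_sys_def by auto
qed


section \<open>The first \<open>\<omega>\<close> elements\<close>

lemma first_elems_infinity: "first_elems \<infinity> R = {x \<in> Field R. finite (underS R x)}"
  unfolding first_elems_def by auto

lemma first_elems_downward:
  assumes "Well_order R" "x \<in> first_elems \<infinity> R" "y \<in> underS R x"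
  shows "y \<in> first_elems \<infinity> R"
proof -
  have "trans R" "antisym R"
    using assms(1) unfolding well_order_on_def linear_order_on_def partial_order_on_def
      preorder_on_def by auto
  then have "underS R y \<subseteq> underS R x"
    using assms(3) by (auto simp: underS_def dest: transD antisymD)
  then show ?thesis
    using assms(2,3) unfolding first_elems_infinity
    by (auto simp: underS_def intro: finite_subset FieldI1)
qed

text \<open>The least element outside a finite set of first elements would have only finitely many
  predecessors, and so would be a first element itself.\<close>

lemma infinite_first_elems:
  assumes "Well_order R" "infinite (Field R)"
  shows "infinite (first_elems \<infinity> R)"
proof
  have wo: "wo_rel R" using assms(1) by (simp add: wo_rel_def)
  assume fin: "finite (first_elems \<infinity> R)"
  define B m where "B = Field R - first_elems \<infinity> R" and "m = wo_rel.minim R B"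
  have B: "B \<subseteq> Field R" "B \<noteq> {}"
    using assms(2) fin unfolding B_def by (auto dest: finite_subset)
  have m: "m \<in> B" "\<And>b. b \<in> B \<Longrightarrow> (m, b) \<in> R"
    using wo_rel.minim_in[OF wo B] wo_rel.minim_least[OF wo B(1)] unfolding m_def by auto
  have "underS R m \<subseteq> first_elems \<infinity> R"
  proof
    fix x assume x: "x \<in> underS R m"
    then have "x \<in> Field R" by (auto simp: underS_def intro: FieldI1)
    moreover have "x \<notin> B"
      using x m(2) wo_rel.ANTISYM[OF wo] by (auto simp: underS_def dest: antisymD)
    ultimately show "x \<in> first_elems \<infinity> R" unfolding B_def by simp
  qed
  then have "m \<in> first_elems \<infinity> R"
    using fin m(1) B(1) unfolding first_elems_infinity by (auto intro: finite_subset)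
  then show False
    using m(1) unfolding B_def by simp
qed

text \<open>Closure under predecessors lets \<open>T\<close> absorb finite predecessor sets later,
  and size \<open>N\<close> leaves room for the values of a given condition. Adding to finitely many
  points of finite rank all their predecessors keeps the set finite.\<close>

lemma finite_initial_segment:
  assumes "Well_order R" "finite A"
  obtains T where "finite T" "A \<inter> first_elems \<infinity> R \<subseteq> T" "T \<subseteq> first_elems \<infinity> R"
    "\<And>x. x \<in> T \<Longrightarrow> underS R x \<subseteq> T" "infinite (Field R) \<Longrightarrow> N \<le> card T"
proof -
  \<comment> \<open>If the field is finite, the size clause is vacuous and \<open>B\<close> may be
    empty.\<close>
  obtain B where B: "finite B" "B \<subseteq> first_elems \<infinity> R" "infinite (Field R) \<Longrightarrow> card B = N"
    using infinite_first_elems[OF assms(1)] infinite_arbitrarily_large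
    by (metis empty_subsetI finite.emptyI)
  define C where "C = B \<union> A \<inter> first_elems \<infinity> R"
  define T where "T = C \<union> (\<Union>x\<in>C. underS R x)"
  have C: "finite C" "C \<subseteq> first_elems \<infinity> R"
    using B assms(2) unfolding C_def by auto
  then have fin: "finite T"
    unfolding T_def first_elems_infinity by blast
  have "trans R" "antisym R"
    using assms(1) unfolding well_order_on_def linear_order_on_def partial_order_on_def
      preorder_on_def by auto
  then have "underS R x \<subseteq> T" if "x \<in> T" for x
    using that unfolding T_def underS_def by (auto dest: transD antisymD)
  moreover have "T \<subseteq> first_elems \<infinity> R"
    using C(2) first_elems_downward[OF assms(1)] unfolding T_def by blast
  moreover have "N \<le> card T" if "infinite (Field R)"
    using B(3)[OF that] card_mono[OF fin, of B] unfolding T_def C_def by auto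
  ultimately show thesis
    using that[of T] fin unfolding T_def C_def by blast
qed

text \<open>\<open>D - D0\<close> and the numbers below \<open>card D\<close> not taken by
  \<open>f\<close> are equinumerous, so any bijection between them completes
  \<open>f\<close>.\<close>

lemma extend_inj_to_initial_segment:
  fixes f :: "'b \<Rightarrow> nat"
  assumes "finite D" "D0 \<subseteq> D" "inj_on f D0" "f ` D0 \<subseteq> {..<card D}"
  shows "\<exists>h. bij_betw h D {..<card D} \<and> (\<forall>x\<in>D0. h x = f x)"
proof -
  have "finite D0" using assms(1,2) finite_subset by blast
  have "card (D - D0) = card ({..<card D} - f ` D0)"
    using assms \<open>finite D0\<close> by (simp add: card_Diff_subset card_image)
  then obtain k where k: "bij_betw k (D - D0) ({..<card D} - f ` D0)"
    using finite_same_card_bij[of "D - D0" "{..<card D} - f ` D0"] assms(1) by auto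
  define h where "h = (\<lambda>x. if x \<in> D0 then f x else k x)"
  have "bij_betw h D0 (f ` D0)"
    using assms(3) unfolding h_def bij_betw_def by (auto simp: inj_on_def)
  moreover have "bij_betw h (D - D0) ({..<card D} - f ` D0)"
    using k unfolding h_def by (subst bij_betw_cong[where g = k]) auto
  ultimately have "bij_betw h (D0 \<union> (D - D0)) (f ` D0 \<union> ({..<card D} - f ` D0))"
    by (rule bij_betw_combine) auto
  moreover have "D0 \<union> (D - D0) = D" "f ` D0 \<union> ({..<card D} - f ` D0) = {..<card D}"
    using assms(2,4) by auto
  ultimately show ?thesis
    unfolding h_def by auto
qed

section \<open>Predecessor sets under niceness\<close>

locale nice_system =
  fixes n :: nat and r :: "'a rel" and L :: "'a set \<Rightarrow> 'a rel"
  assumes Well_order_r: "Well_order r"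
    and nice: "nice_ordering_system n r L"
begin

lemma system: "ordering_system n (Field r) L"
  using nice unfolding nice_ordering_system_def by simp

lemma Min_index:
  assumes "s \<in> nsets (Field r) n"
  shows "s - {Min_sys L s} \<in> nsets_less (Field r) n"
    and "Well_order (L (s - {Min_sys L s}))"
    and "Field (L (s - {Min_sys L s})) \<subseteq> Field r"
proof -
  have "card (s - {Min_sys L s}) < n" "finite s" "s \<subseteq> Field r"
    using assms Min_sys(1)[OF system assms] card_Diff1_less[of s "Min_sys L s"] by (auto simp: nsets_def)
  then show "s - {Min_sys L s} \<in> nsets_less (Field r) n"
    "Well_order (L (s - {Min_sys L s}))" "Field (L (s - {Min_sys L s})) \<subseteq> Field r"
    using ordering_system_Well_order[OF system, of "s - {Min_sys L s}"]
    by (auto simp: nsets_less_def)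
qed

lemma predom_eq_underS:
  assumes "s \<in> nsets (Field r) n"
  shows "predom L s = underS (L (s - {Min_sys L s})) (Min_sys L s)"
  unfolding predom_def Let_def dom_of_Well_order[OF Min_index(2)[OF assms]]
  by (auto simp: strict_def underS_def intro: FieldI1)

lemma predom_subset: "s \<in> nsets (Field r) n \<Longrightarrow> predom L s \<subseteq> Field r"
  using Min_index(3)[of s] by (auto simp: predom_eq_underS underS_def intro: FieldI1)

text \<open>With \<open>y\<close> the minimum of \<open>s\<close>, the order \<open>R\<close> has
  infinite field, so niceness gives \<open>R\<close> and \<open>r\<close> the same first \<omega>
  elements. Since \<open>y\<close> has infinitely many \<open>R\<close>-predecessors, it lies above
  all of these.\<close>

lemma first_elems_subset_predom:
  assumes "s \<in> Inf_sets n r L"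
  shows "first_elems \<infinity> r \<subseteq> predom L s"
proof -
  have s: "s \<in> nsets (Field r) n" and inf: "infinite (predom L s)"
    using assms unfolding Inf_sets_def by auto
  define y R where "y = Min_sys L s" and "R = L (s - {y})"
  have R: "Well_order R" "predom L s = underS R y"
    using Min_index(2)[OF s] predom_eq_underS[OF s] unfolding y_def R_def by auto
  have y: "y \<in> Field R"
    using Min_sys(2)[OF system s] dom_of_Well_order[OF R(1)] unfolding y_def R_def by simp
  have "underS R y \<subseteq> Field R"
    by (auto simp: underS_def intro: FieldI1)
  then have "infinite (dom_of R)"
    using inf R by (auto simp: dom_of_Well_order dest: finite_subset)
  then have "first_elems \<infinity> r = first_elems \<infinity> R"
    using nice Min_index(1)[OF s]
    unfolding nice_ordering_system_def size_upto_omega_def Let_def y_def R_def by auto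
  also have "\<dots> \<subseteq> underS R y"
  proof
    fix x assume x: "x \<in> first_elems \<infinity> R"
    then have "x \<in> Field R" unfolding first_elems_infinity by simp
    moreover have "y \<notin> first_elems \<infinity> R"
      using inf R(2) unfolding first_elems_infinity by simp
    then have "y \<noteq> x" "y \<notin> underS R x"
      using x first_elems_downward[OF R(1) x] by auto
    ultimately show "x \<in> underS R y"
      using y wo_rel.TOTALS[of R] R(1) by (auto simp: underS_def wo_rel_def)
  qed
  finally show ?thesis using R(2) by simp
qed

text \<open>Now \<open>y\<close> sits at a finite position of \<open>R\<close>, so \<open>y\<close>
  and its predecessors are among the first \<open>\<alpha>\<close> elements, where niceness makes
  \<open>R\<close> and \<open>r\<close> agree.\<close>

lemma finite_predom:
  assumes s: "s \<in> nsets (Field r) n" and fin: "finite (predom L s)"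
  shows "Min_sys L s \<in> first_elems \<infinity> r" "predom L s \<subseteq> underS r (Min_sys L s)"
proof -
  define y R where "y = Min_sys L s" and "R = L (s - {y})"
  define \<alpha> where "\<alpha> = size_upto_omega (dom_of R)"
  have R: "Well_order R" "predom L s = underS R y"
    using Min_index(2)[OF s] predom_eq_underS[OF s] unfolding y_def R_def by auto
  have y: "y \<in> Field R"
    using Min_sys(2)[OF system s] dom_of_Well_order[OF R(1)] unfolding y_def R_def by simp
  have sub: "underS R x \<subseteq> underS R y" if "x \<in> insert y (underS R y)" for x
  proof -
    have "trans R" "antisym R"
      using R(1) unfolding well_order_on_def linear_order_on_def partial_order_on_def
        preorder_on_def by auto
    then show ?thesis using that by (auto simp: underS_def dest: transD antisymD)
  qed
  \<comment> \<open>The inequality is strict also for finite \<open>R\<close>, because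
    \<open>y\<close> is in the field but not among its own predecessors.\<close>
  have "enat (card (underS R y)) < \<alpha>"
  proof (cases "finite (Field R)")
    case True
    have "underS R y \<subset> Field R"
      using y by (auto simp: underS_def intro: FieldI1)
    then show ?thesis
      using True psubset_card_mono[OF True] R(1)
      unfolding \<alpha>_def size_upto_omega_def by (simp add: dom_of_Well_order)
  next
    case False
    then show ?thesis
      using R(1) unfolding \<alpha>_def size_upto_omega_def by (simp add: dom_of_Well_order)
  qed
  then have "enat (card (underS R x)) < \<alpha>" if "x \<in> insert y (underS R y)" for x
    using card_mono[OF _ sub[OF that]] fin R(2) by (metis enat_ord_simps(1) le_less_trans)
  moreover have "finite (underS R x)" if "x \<in> insert y (underS R y)" for x
    using sub[OF that] fin R(2) by (auto intro: finite_subset)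
  moreover have "x \<in> Field R" if "x \<in> insert y (underS R y)" for x
    using that y by (auto simp: underS_def intro: FieldI1)
  ultimately have "insert y (underS R y) \<subseteq> first_elems \<alpha> R"
    unfolding first_elems_def by blast
  moreover have "first_elems \<alpha> R = first_elems \<alpha> r"
    and agree: "\<And>x z. x \<in> first_elems \<alpha> r \<Longrightarrow> z \<in> first_elems \<alpha> r \<Longrightarrow>
      (x, z) \<in> strict R \<longleftrightarrow> (x, z) \<in> strict r"
    using nice Min_index(1)[OF s]
    unfolding nice_ordering_system_def Let_def \<alpha>_def R_def y_def by auto
  ultimately have first: "insert y (underS R y) \<subseteq> first_elems \<alpha> r" by simp
  then have "y \<in> first_elems \<infinity> r"
    unfolding first_elems_def by auto
  moreover have "underS R y \<subseteq> underS r y"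
  proof
    fix x assume x: "x \<in> underS R y"
    then have "(x, y) \<in> strict r"
      using agree[of x y] first by (auto simp: strict_def underS_def)
    then show "x \<in> underS r y" by (auto simp: strict_def underS_def)
  qed
  ultimately show "Min_sys L s \<in> first_elems \<infinity> r" "predom L s \<subseteq> underS r (Min_sys L s)"
    using R(2) unfolding y_def by auto
qed


section \<open>The closing condition\<close>

text \<open>The last clause makes the values of \<open>q\<close> on
  \<open>S \<inter> predom L s\<close> an initial segment of \<omega>. Any value below one attained
  there is thus occupied inside \<open>S\<close>, so injectivity keeps points outside
  \<open>S\<close> from coming below points of \<open>S\<close>.\<close>

lemma closing_condition:
  assumes p: "p \<in> Q_conds n r L" and A: "finite A" "A \<subseteq> Field r"
  shows "\<exists>q\<in>Q_conds n r L. Q_le q p \<and> (\<exists>S. finite S \<and> A \<subseteq> S \<and> S \<subseteq> Field r \<and>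
    (\<forall>s\<in>nsets (Field r) n - Inf_sets n r L. s \<subseteq> S \<longrightarrow> predom L s \<subseteq> S) \<and>
    (\<forall>s\<in>Inf_sets n r L. s \<subseteq> S \<longrightarrow> (\<forall>x\<in>S \<inter> predom L s.
      \<exists>l. q (x, s) = Some l \<and> (\<forall>k<l. \<exists>c\<in>S. q (c, s) = Some k))))"
proof -
  let ?Inf = "Inf_sets n r L"
  have p1: "finite (dom p)" "dom p \<subseteq> Q_dom n r L"
    and p_inj: "\<And>s. s \<in> ?Inf \<Longrightarrow> inj_on (\<lambda>x. p (x, s)) {x. (x, s) \<in> dom p}"
    using p unfolding Q_conds_def by auto
  have Inf: "s \<in> nsets (Field r) n" "infinite (predom L s)" if "s \<in> ?Inf" for s
    using that unfolding Inf_sets_def by auto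
  have dom_p: "s \<in> ?Inf \<and> x \<in> predom L s" if "(x, s) \<in> dom p" for x s
    using p1(2) that unfolding Q_dom_def by auto
  have "finite (ran p)" using p1(1) by (rule finite_ran)
  then obtain N where N: "\<And>k. k \<in> ran p \<Longrightarrow> k < N"
    by (meson finite_nat_set_iff_bounded)
  \<comment> \<open>Adding the points mentioned by \<open>p\<close> puts every fiber of
    \<open>p\<close> inside \<open>S\<close>, so the enumerations chosen below can extend
    \<open>p\<close>.\<close>
  define S1 where "S1 = A \<union> fst ` dom p"
  have "x \<in> Field r" if "(x, s) \<in> dom p" for x s
    using dom_p[OF that] Inf(1) predom_subset by blast
  then have S1: "finite S1" "S1 \<subseteq> Field r"
    using A p1(1) unfolding S1_def by (simp, force)
  \<comment> \<open>As \<open>T\<close> contains the natural numbers of \<open>S1\<close>, it will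
    contain all natural numbers of \<open>S\<close>; these are then closed downward in
    \<open>r\<close>.\<close>
  obtain T where T: "finite T" "S1 \<inter> first_elems \<infinity> r \<subseteq> T" "T \<subseteq> first_elems \<infinity> r"
    "\<And>x. x \<in> T \<Longrightarrow> underS r x \<subseteq> T" "infinite (Field r) \<Longrightarrow> N \<le> card T"
    using finite_initial_segment[OF Well_order_r S1(1), where N = N] by metis
  define S where "S = S1 \<union> T"
  have S: "finite S" "A \<subseteq> S" "S \<subseteq> Field r"
    using S1 T(1,3) unfolding S_def S1_def first_elems_infinity by auto
  have dom_S: "x \<in> S" if "(x, s) \<in> dom p" for x s
    using that unfolding S_def S1_def by force
  define D where "D s = S \<inter> predom L s" for s
  have "\<exists>h. bij_betw h (D s) {..<card (D s)} \<and>
      (\<forall>x\<in>{x. (x, s) \<in> dom p}. h x = the (p (x, s)))" if s: "s \<in> ?Inf" for s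
  proof (rule extend_inj_to_initial_segment)
    show fin: "finite (D s)" using S(1) unfolding D_def by simp
    show "{x. (x, s) \<in> dom p} \<subseteq> D s"
      using dom_S dom_p unfolding D_def by blast
    show "inj_on (\<lambda>x. the (p (x, s))) {x. (x, s) \<in> dom p}"
      using p_inj[OF s] unfolding inj_on_def by (auto simp: domIff)
    \<comment> \<open>The size bound on \<open>T\<close> is conditional on an infinite field, which
      the infinite set \<open>predom L s\<close> provides.\<close>
    have "infinite (Field r)"
      using Inf[OF s] predom_subset finite_subset by blast
    moreover have "T \<subseteq> D s"
      using T(3) first_elems_subset_predom[OF s] unfolding D_def S_def by blast
    ultimately have "N \<le> card (D s)"
      using T(5) card_mono[OF fin] le_trans by blast
    then show "(\<lambda>x. the (p (x, s))) ` {x. (x, s) \<in> dom p} \<subseteq> {..<card (D s)}"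
      using N by (fastforce simp: ran_def)
  qed
  then obtain h where h: "\<And>s. s \<in> ?Inf \<Longrightarrow> bij_betw (h s) (D s) {..<card (D s)}"
    and h_p: "\<And>s x. s \<in> ?Inf \<Longrightarrow> (x, s) \<in> dom p \<Longrightarrow> h s x = the (p (x, s))"
    by (metis (no_types, lifting) mem_Collect_eq)
  \<comment> \<open>Only fibers over the finitely many \<open>s \<subseteq> S\<close> can receive
    new values, which keeps \<open>dom q\<close> finite; elsewhere \<open>q\<close> is
    \<open>p\<close>.\<close>
  define q where "q = (\<lambda>(x, s). if s \<in> ?Inf \<and> s \<subseteq> S \<and> x \<in> D s then Some (h s x) else p (x, s))"
  have q_new: "q (x, s) = Some (h s x)" if "s \<in> ?Inf" "s \<subseteq> S" "x \<in> D s" for x s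
    using that unfolding q_def by simp
  have q_old: "q (x, s) = p (x, s)" if "\<not> s \<subseteq> S" for x s
    using that unfolding q_def by simp
  have dom_q: "(x, s) \<in> dom q \<longleftrightarrow> x \<in> D s" if "s \<in> ?Inf" "s \<subseteq> S" for x s
    using that dom_S[of x s] dom_p[of x s] unfolding q_def D_def by (auto simp: domIff split: if_splits)
  have "dom q \<subseteq> dom p \<union> S \<times> Pow S"
    unfolding q_def D_def by (auto simp: domIff split: if_splits)
  then have "finite (dom q)"
    using p1(1) S(1) by (auto intro: finite_subset)
  moreover have "dom q \<subseteq> Q_dom n r L"
  proof (rule subsetI)
    fix z assume "z \<in> dom q"
    then have "z \<in> dom p \<or> (\<exists>s\<in>?Inf. z \<in> predom L s \<times> {s})"
      unfolding q_def D_def by (cases z) (auto simp: domIff split: if_splits)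
    then show "z \<in> Q_dom n r L"
      using p1(2) unfolding Q_dom_def by blast
  qed
  moreover have "inj_on (\<lambda>x. q (x, s)) {x. (x, s) \<in> dom q}" if s: "s \<in> ?Inf" for s
  proof (cases "s \<subseteq> S")
    case True
    then have "{x. (x, s) \<in> dom q} = D s" using dom_q[OF s] by auto
    then show ?thesis
      using h[OF s] q_new[OF s True] unfolding bij_betw_def inj_on_def by auto
  next
    case False
    then show ?thesis using p_inj[OF s] by (simp add: q_old domIff)
  qed
  ultimately have q: "q \<in> Q_conds n r L"
    unfolding Q_conds_def by simp
  have "Q_le q p"
    using h_p unfolding Q_le_def map_le_def q_def by (auto simp: domIff)
  moreover have "predom L s \<subseteq> S" if "s \<in> nsets (Field r) n - ?Inf" "s \<subseteq> S" for s
  proof -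
    have s: "s \<in> nsets (Field r) n" "finite (predom L s)"
      using that unfolding Inf_sets_def by auto
    have "Min_sys L s \<in> T"
      using finite_predom(1)[OF s] Min_sys(1)[OF system s(1)] that(2) T(2) unfolding S_def by blast
    then show ?thesis
      using T(4) finite_predom(2)[OF s] unfolding S_def by blast
  qed
  moreover have "\<exists>l. q (x, s) = Some l \<and> (\<forall>k<l. \<exists>c\<in>S. q (c, s) = Some k)"
    if s: "s \<in> ?Inf" "s \<subseteq> S" and x: "x \<in> S \<inter> predom L s" for s x
  proof -
    have x': "x \<in> D s" using x unfolding D_def .
    have im: "h s ` D s = {..<card (D s)}"
      using h[OF s(1)] unfolding bij_betw_def by simp
    have "\<exists>c\<in>S. q (c, s) = Some k" if "k < h s x" for k
    proof -
      have "k \<in> h s ` D s"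
        using that im x' by (metis imageI lessThan_iff less_trans)
      then obtain c where "c \<in> D s" "h s c = k" by auto
      then show ?thesis using q_new[OF s] unfolding D_def by auto
    qed
    then show ?thesis using q_new[OF s x'] by auto
  qed
  ultimately show ?thesis
    using q S by (intro bexI[of _ q] conjI exI[of _ S] ballI impI) simp_all
qed

end


section \<open>Finite closures\<close>

context nice_system
begin

interpretation preorder_forcing "Q_conds n r L" Q_le
  by (rule preorder_forcing_Q)

text \<open>After strengthening, some \<open>a\<close> with value \<open>k\<close> is forced into
  the generic filter; a condition below both \<open>a\<close> and the current one carries that value
  itself.\<close>

lemma g_eqE:
  assumes "g_eq n r L x s k p" "p \<in> Q_conds n r L"
  obtains q where "q \<in> Q_conds n r L" "Q_le q p" "q (x, s) = Some k"
proof -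
  obtain a p1 where p1: "p1 \<in> Q_conds n r L" "Q_le p1 p" "fmem a gen p1" "a (x, s) = Some k"
    using assms unfolding g_eq_def fconj_def fground_def by (elim fexE) auto
  obtain q where q: "q \<in> Q_conds n r L" "Q_le q p1" "Q_le q a"
    using fmem_gen[OF p1(3,1)] .
  have "q (x, s) = Some k"
    using q(3) p1(4) unfolding Q_le_def map_le_def by (metis domI)
  then show thesis using that q(1,2) p1(2) le_trans by blast
qed

lemma g_lessE:
  assumes "g_less n r L s x y p" "p \<in> Q_conds n r L"
  obtains q k l where "q \<in> Q_conds n r L" "Q_le q p" "q (x, s) = Some k" "q (y, s) = Some l" "k < l"
proof -
  obtain k p1 where p1: "p1 \<in> Q_conds n r L" "Q_le p1 p"
    "fex UNIV (\<lambda>l. fconj (g_eq n r L x s k) (fconj (g_eq n r L y s l) (fground (k < l)))) p1"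
    using assms unfolding g_less_def by (elim fexE[where p = p])
  then obtain l p2 where p2: "p2 \<in> Q_conds n r L" "Q_le p2 p1"
    "g_eq n r L x s k p2" "g_eq n r L y s l p2" "k < l"
    unfolding fconj_def fground_def by (elim fexE) auto
  obtain p3 where p3: "p3 \<in> Q_conds n r L" "Q_le p3 p2" "p3 (x, s) = Some k"
    using g_eqE[OF p2(3,1)] .
  \<comment> \<open>The second formula passes down to \<open>p3\<close> before it is decided there;
    the first value survives because \<open>p4\<close> extends \<open>p3\<close>.\<close>
  have "g_eq n r L y s l p3"
    using p2(4) p3(2) fex_mono unfolding g_eq_def by blast
  then obtain p4 where p4: "p4 \<in> Q_conds n r L" "Q_le p4 p3" "p4 (y, s) = Some l"
    using g_eqE p3(1) by blast
  have "p4 (x, s) = Some k"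
    using p4(2) p3(3) unfolding Q_le_def map_le_def by (metis domI)
  then show thesis
    using that p4 p3(2) p2(2,5) p1(2) le_trans by blast
qed

text \<open>In the infinite case, if a condition below \<open>q\<close> puts \<open>a\<close>
  strictly below \<open>b \<in> S\<close>, an extension \<open>p2\<close> gives them values
  \<open>k < l\<close>, with \<open>l\<close> already fixed by \<open>q\<close>. So \<open>k\<close>
  is the \<open>q\<close>-value of some \<open>c \<in> S\<close>, and injectivity of
  \<open>p2\<close> over \<open>s\<close> yields \<open>a = c\<close>.\<close>

lemma forces_closed:
  assumes q: "q \<in> Q_conds n r L"
    and fin: "\<forall>s\<in>nsets (Field r) n - Inf_sets n r L. s \<subseteq> S \<longrightarrow> predom L s \<subseteq> S"
    and inf: "\<forall>s\<in>Inf_sets n r L. s \<subseteq> S \<longrightarrow> (\<forall>x\<in>S \<inter> predom L s.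
      \<exists>l. q (x, s) = Some l \<and> (\<forall>k<l. \<exists>c\<in>S. q (c, s) = Some k))"
    and q': "Q_le q' q"
  shows "fclosed (n + 1) (Field r) (generic_system n r L) (S \<times> Q_conds n r L) q'"
proof -
  \<comment> \<open>Membership in the check name of \<open>S\<close> is a ground model fact, so it
    suffices to derive \<open>a \<in> S\<close> outright from any such \<open>p\<close>.\<close>
  have "a \<in> S" if s: "s \<in> nsets (Field r) n" "s \<subseteq> S" and b: "b \<in> S"
    and p: "p \<in> Q_conds n r L" "Q_le p q'" "generic_system n r L s a b p" "a \<noteq> b" for s a b p
  proof (cases "s \<in> Inf_sets n r L")
    case False
    \<comment> \<open>As \<open>card s = n\<close>, the first branch of
      \<open>generic_system\<close> is excluded.\<close>
    then have "a \<in> predom L s"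
      using s(1) p(3) by (auto simp: generic_system_def nsets_def nsets_less_def fground_def)
    then show ?thesis using fin s False by blast
  next
    case True
    have ab: "b \<in> predom L s" "fdisj (fground (a = b)) (g_less n r L s a b) p"
      using True s(1) p(3)
      by (auto simp: generic_system_def nsets_def nsets_less_def fground_def fconj_def)
    then obtain p1 where p1: "p1 \<in> Q_conds n r L" "Q_le p1 p" "g_less n r L s a b p1"
      using p(1,4) by (elim fdisjE) (auto simp: fground_def)
    obtain p2 k l where p2: "p2 \<in> Q_conds n r L" "Q_le p2 p1" "p2 (a, s) = Some k"
      "p2 (b, s) = Some l" "k < l"
      using g_lessE[OF p1(3,1)] .
    have "Q_le p2 q"
      using p2(2) p1(2) p(2) q' le_trans by blast
    then have ext: "p2 z = Some v" if "q z = Some v" for z v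
      using that unfolding Q_le_def map_le_def by (metis domI)
    obtain l' where "q (b, s) = Some l'" and l': "\<And>k. k < l' \<Longrightarrow> \<exists>c\<in>S. q (c, s) = Some k"
      using inf True s(2) b ab(1) by blast
    then have "l' = l" using ext p2(4) by fastforce
    then obtain c where c: "c \<in> S" "p2 (c, s) = Some k"
      using l' p2(5) ext by blast
    have "inj_on (\<lambda>x. p2 (x, s)) {x. (x, s) \<in> dom p2}"
      using p2(1) True unfolding Q_conds_def by blast
    then have "a = c" by (rule inj_onD) (use c(2) p2(3) in auto)
    then show ?thesis using c(1) by simp
  qed
  then show ?thesis
    unfolding fclosed_def fall_def
    by (auto intro!: fimpI simp: fmem_check fconj_def fstrict_def fground_def)
      (meson le_trans subsetI)
qed

text \<open>By density it is enough to extend each \<open>p\<close> that forces \<open>A\<close> to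
  be finite. Strengthen first to \<open>p1\<close>, which bounds \<open>A\<close> by a finite ground
  model set \<open>B\<close>, then to a closing condition for \<open>B\<close>; the check name of
  the resulting \<open>S\<close> is the witness.\<close>

lemma forced_finite_closures:
  "forced (fhas_finite_closures (n + 1) (Field r) (generic_system n r L))"
  unfolding forced_def fhas_finite_closures_def fall_def
proof (intro ballI fimp_iff[THEN iffD2] impI)
  let ?P = "Q_conds n r L" and ?X = "Field r"
  fix A p0 p assume p: "p \<in> ?P" "ffinite ?X A p"
  obtain p1 B where p1: "p1 \<in> ?P" "Q_le p1 p" "B \<subseteq> ?X" "finite B"
    and B: "\<And>q x. q \<in> ?P \<Longrightarrow> Q_le q p1 \<Longrightarrow> x \<in> ?X \<Longrightarrow> fmem x A q \<Longrightarrow> x \<in> B"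
    using ffinite_cover[OF p(2,1)] by metis
  obtain q S where q: "q \<in> ?P" "Q_le q p1" "finite S" "B \<subseteq> S" "S \<subseteq> ?X"
    and S: "\<forall>s\<in>nsets ?X n - Inf_sets n r L. s \<subseteq> S \<longrightarrow> predom L s \<subseteq> S"
      "\<forall>s\<in>Inf_sets n r L. s \<subseteq> S \<longrightarrow> (\<forall>x\<in>S \<inter> predom L s.
        \<exists>l. q (x, s) = Some l \<and> (\<forall>k<l. \<exists>c\<in>S. q (c, s) = Some k))"
    using closing_condition[OF p1(1,4,3)] by (elim bexE exE conjE) (rule that)
  have "fsubset ?X A (S \<times> ?P) q'" if "q' \<in> ?P" "Q_le q' q" for q'
    unfolding fsubset_def fall_def
  proof (intro ballI fimpI)
    fix x q'' assume x: "x \<in> ?X" and q'': "q'' \<in> ?P" "Q_le q'' q'" and A: "fmem x A q''"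
    have "Q_le q'' p1"
      using le_trans[OF q''(2) le_trans[OF that(2) q(2)]] .
    then have "x \<in> S"
      using B[OF q''(1) _ x A] q(4) by auto
    then show "fmem x (S \<times> ?P) q''"
      using fmem_check[OF q''(1), of x S] by simp
  qed
  moreover have "S \<times> ?P \<in> names ?X"
    using q(5) unfolding names_def by auto
  ultimately have "fex (names ?X) (\<lambda>S. fconj (fsubset ?X A S)
      (fconj (ffinite ?X S) (fclosed (n + 1) ?X (generic_system n r L) S))) q"
    using forces_closed[OF q(1) S] ffinite_check[OF q(3,5)]
    by (intro fexI[of "S \<times> ?P"]) (auto simp: fconj_def)
  then show "\<exists>q'\<in>?P. Q_le q' p \<and> fex (names ?X) (\<lambda>S. fconj (fsubset ?X A S)
      (fconj (ffinite ?X S) (fclosed (n + 1) ?X (generic_system n r L) S))) q'"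
    using q(1,2) p1(2) le_trans by blast
qed

end

lemma omega_order_Well_order: "omega_order k r \<Longrightarrow> Well_order r"
  by (cases k) (auto simp: ordIso_def)

theorem theorem5p20:
  fixes n :: nat and r :: "'a rel" and L :: "'a set \<Rightarrow> 'a rel"
  assumes "n \<ge> 2"
    and "omega_order n r"
    and "nice_ordering_system n r L"
    and "order_type_bounded n (Field r) L"
  shows "forcing.forced (Q_conds n r L)
    (forcing.fhas_finite_closures (Q_conds n r L) Q_le (n + 1) (Field r) (generic_system n r L))"
proof -
  interpret nice_system n r L
    using assms(2,3) omega_order_Well_order by unfold_locales
  show ?thesis by (rule forced_finite_closures)
qed

end
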